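(* For all real $x_1,x_2$ and all $\lambda\in[0,1]$, $$\omega_3(\lambda x_1+(1-\lambda)x_2)\le \lambda\,\omega_3(x_1)+(1-\lambda)\,\omega_3(x_2)+\omega_3(\lambda)\,|x_2-x_1|.$$
   Context: For real $x$, $\|x\|$ denotes the distance from $x$ to the nearest integer, and $\|x\|_{1/3}:=\min\{\|x\|,1/3\}$. Define $\omega_3(x):=\sum_{k=0}^\infty 3^{-k}\|3^kx\|_{1/3}$ for real $x$. *)

theory Defs
  imports "HOL-Analysis.Analysis"
begin

definition int_dist :: "real \<Rightarrow> real" where
  "int_dist x = infdist x \<int>"

definition int_dist_third :: "real \<Rightarrow> real" where
  "int_dist_third x = min (int_dist x) (1/3)"

definition omega3 :: "real \<Rightarrow> real" where
  "omega3 x = (\<Sum>k. int_dist_third (3 ^ k * x) / 3 ^ k)"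

lemma int_dist_third_bounds: "0 \<le> int_dist_third x" "int_dist_third x \<le> 1/3"
  by (auto simp: int_dist_third_def int_dist_def infdist_nonneg)

lemma omega3_summable: "summable (\<lambda>k. int_dist_third (3 ^ k * x) / 3 ^ k)"
proof (rule summable_comparison_test')
  show "summable (\<lambda>k. (1/3 :: real) ^ k)"
    by (rule summable_geometric) simp
  show "norm (int_dist_third (3 ^ k * x) / 3 ^ k) \<le> (1/3) ^ k" if "k \<ge> 0" for k
    using int_dist_third_bounds[of "3 ^ k * x"]
    by (simp add: power_one_over divide_right_mono)
qed

end

theory Submission
  imports Defs
begin

text \<open>
  The heart of the matter is the case of three equal weights: for all reals \<open>a, b, c\<close>,
  \<open>3 \<omega>\<^sub>3((a + b + c)/3) \<le> \<omega>\<^sub>3(a) + \<omega>\<^sub>3(b) + \<omega>\<^sub>3(c) + (max - min)\<close>; it is the induction step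
  of Lindsey's edge-isoperimetric inequality in powers of the complete graph \<open>K\<^sub>3\<close>.
  The functional equation \<open>\<omega>\<^sub>3(x) = \<parallel>x\<parallel>\<^sub>1\<^sub>/\<^sub>3 + \<omega>\<^sub>3(3x)/3\<close> shows that the
  defect of this inequality at \<open>(a, b, c)\<close> is at most a third of the defect at the fractional parts
  of \<open>(3a, 3b, 3c)\<close>. Being bounded above, the defect is therefore nonpositive everywhere.

  The same contraction argument gives the theorem for fixed \<open>x\<^sub>1, x\<^sub>2\<close>: if
  \<open>t = (j + t')/3\<close> with \<open>j \<in> {0, 1, 2}\<close>, then \<open>t x\<^sub>1 + (1 - t) x\<^sub>2\<close> is the average of
  \<open>t' x\<^sub>1 + (1 - t') x\<^sub>2\<close>, \<open>j\<close> copies of \<open>x\<^sub>1\<close> and \<open>2 - j\<close> copies of \<open>x\<^sub>2\<close>, so the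
  three-point inequality bounds the defect at \<open>t\<close> by a third of the defect at \<open>t'\<close>.
\<close>

text \<open>Iterating \<open>step\<close> n times improves the bound \<open>C\<close> to
  \<open>C * (1/3) ^ n\<close>, which tends to 0.\<close>

lemma contraction_nonpos:
  fixes f :: "'a \<Rightarrow> real"
  assumes bdd: "\<And>a. a \<in> A \<Longrightarrow> f a \<le> C"
    and step: "\<And>a. a \<in> A \<Longrightarrow> \<exists>b\<in>A. f a \<le> f b / 3"
    and "a \<in> A"
  shows "f a \<le> 0"
proof -
  have "\<forall>a\<in>A. f a \<le> C * (1/3) ^ n" for n
  proof (induction n)
    case 0
    then show ?case using bdd by simp
  next
    case (Suc n)
    show ?case
    proof
      fix a assume "a \<in> A"
      then obtain b where "b \<in> A" "f a \<le> f b / 3"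
        using step by blast
      then show "f a \<le> C * (1/3) ^ Suc n"
        using Suc.IH by fastforce
    qed
  qed
  moreover have "(\<lambda>n. C * (1/3) ^ n) \<longlonglongrightarrow> C * 0"
    by (intro tendsto_mult tendsto_const LIMSEQ_realpow_zero) auto
  ultimately show ?thesis
    using \<open>a \<in> A\<close> by (auto intro: LIMSEQ_le_const)
qed

section \<open>Periodicity, functional equation and bounds of \<open>omega3\<close>\<close>

lemma int_dist_third_add_int:
  assumes "0 \<le> r" "r \<le> 1"
  shows "int_dist_third (of_int m + r) = min (min r (1 - r)) (1/3)"
proof -
  have "int_dist (of_int m + r) = min r (1 - r)"
  proof (rule antisym)
    have "int_dist (of_int m + r) \<le> dist (of_int m + r) (of_int m)"
      "int_dist (of_int m + r) \<le> dist (of_int m + r) (of_int (m + 1))"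
      unfolding int_dist_def by (intro infdist_le Ints_of_int)+
    then show "int_dist (of_int m + r) \<le> min r (1 - r)"
      using assms by (auto simp: dist_real_def)
    have "min r (1 - r) \<le> dist (of_int m + r) z" if z: "z \<in> \<int>" for z
    proof -
      obtain k where k: "z = of_int k" using z by (elim Ints_cases)
      show ?thesis
      proof (cases "k \<le> m")
        case True
        then have "real_of_int k \<le> of_int m" by simp
        then show ?thesis using k by (auto simp: dist_real_def)
      next
        case False
        then have "real_of_int (m + 1) \<le> of_int k" by linarith
        then show ?thesis using k by (auto simp: dist_real_def)
      qed
    qed
    moreover have "\<int> \<noteq> ({} :: real set)" using Ints_0 by blast
    ultimately show "min r (1 - r) \<le> int_dist (of_int m + r)"
      unfolding int_dist_def infdist_def by (auto intro!: cINF_greatest)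
  qed
  then show ?thesis by (simp add: int_dist_third_def)
qed

lemma int_dist_third_periodic: "int_dist_third (x + of_int m) = int_dist_third x"
proof -
  have "x = of_int \<lfloor>x\<rfloor> + frac x" "x + of_int m = of_int (\<lfloor>x\<rfloor> + m) + frac x"
    by (simp_all add: frac_def)
  moreover have "0 \<le> frac x" "frac x \<le> 1"
    by (simp_all add: frac_lt_1 less_imp_le)
  ultimately show ?thesis
    by (metis int_dist_third_add_int)
qed

lemma omega3_rec: "omega3 x = int_dist_third x + omega3 (3 * x) / 3"
proof -
  have "omega3 x = int_dist_third x + (\<Sum>k. int_dist_third (3 ^ Suc k * x) / 3 ^ Suc k)"
    using suminf_split_head[OF omega3_summable[of x]] by (simp add: omega3_def)
  also have "(\<Sum>k. int_dist_third (3 ^ Suc k * x) / 3 ^ Suc k)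
      = (\<Sum>k. (int_dist_third (3 ^ k * (3 * x)) / 3 ^ k) / 3)"
    by (simp add: mult_ac)
  also have "\<dots> = omega3 (3 * x) / 3"
    unfolding omega3_def by (rule suminf_divide[OF omega3_summable])
  finally show ?thesis by simp
qed

lemma omega3_periodic: "omega3 (x + of_int m) = omega3 x"
proof -
  have "int_dist_third (3 ^ k * (x + of_int m)) = int_dist_third (3 ^ k * x)" for k
    using int_dist_third_periodic[of "3 ^ k * x" "3 ^ k * m"] by (simp add: algebra_simps)
  then show ?thesis by (simp add: omega3_def)
qed

lemma omega3_bounds: "0 \<le> omega3 x" "omega3 x \<le> 1/2"
proof -
  show "0 \<le> omega3 x"
    unfolding omega3_def by (intro suminf_nonneg omega3_summable) (simp add: int_dist_third_bounds)
  have "omega3 x \<le> (\<Sum>k. (1/3) * (1/3) ^ k)"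
    unfolding omega3_def
  proof (intro suminf_le omega3_summable summable_mult summable_geometric)
    show "int_dist_third (3 ^ k * x) / 3 ^ k \<le> (1/3) * (1/3) ^ k" for k
      using int_dist_third_bounds(2)[of "3 ^ k * x"]
      by (simp add: power_one_over divide_right_mono field_simps)
  qed simp
  also have "\<dots> = 1/2"
    by (subst suminf_mult) (simp_all add: suminf_geometric)
  finally show "omega3 x \<le> 1/2" .
qed

section \<open>The rescaled trapezoid wave and its piecewise linear inequality\<close>

text \<open>Rescaled so that the breakpoints are the integers; the period becomes 3.\<close>
definition trap3 :: "real \<Rightarrow> real" where
  "trap3 x = 3 * int_dist_third (x / 3)"

lemma trap3_add_int:
  assumes "0 \<le> y" "y \<le> 3"
  shows "trap3 (3 * of_int m + y) = min (min y (3 - y)) 1"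
  using int_dist_third_add_int[of "y/3" m] assms
  by (auto simp: trap3_def add_divide_distrib min_def)

lemma trap3_bounds: "0 \<le> trap3 x" "trap3 x \<le> 1"
  using int_dist_third_bounds[of "x/3"] by (auto simp: trap3_def)

text \<open>All breakpoints are integers, so \<open>trap3\<close> is affine on each unit interval,
  with slope 1, 0 or -1 according to the residue mod 3.\<close>

lemma trap3_unit:
  assumes "0 \<le> f" "f \<le> 1"
  shows "trap3 (of_int n + f) = (if n mod 3 = 0 then f else if n mod 3 = 1 then 1 else 1 - f)"
proof -
  define k where "k = n mod 3"
  have "k = 0 \<or> k = 1 \<or> k = 2" unfolding k_def by presburger
  moreover have "n = 3 * (n div 3) + k" unfolding k_def by simp
  then have "real_of_int n = 3 * of_int (n div 3) + of_int k" by (metis of_int_add of_int_mult of_int_numeral)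
  then have "trap3 (of_int n + f) = min (min (k + f) (3 - (k + f))) 1"
    using trap3_add_int[of "k + f" "n div 3"] assms calculation by (auto simp: add.assoc)
  ultimately show ?thesis
    using assms unfolding k_def[symmetric] by auto
qed

text \<open>The same for the wave stretched by 3 in both directions: period 9, breakpoints at
  multiples of 3, slopes again 1, 0, -1.\<close>

lemma trap3_third_unit:
  assumes "0 \<le> f" "f \<le> 1"
  shows "3 * trap3 ((of_int n + f) / 3) =
    (if n mod 9 < 3 then of_int (n mod 9) + f else if n mod 9 < 6 then 3 else 9 - of_int (n mod 9) - f)"
proof -
  define k where "k = n mod 9"
  have k: "0 \<le> k" "k < 9" unfolding k_def by simp_all
  have "n = 9 * (n div 9) + k" unfolding k_def by simp
  then have "real_of_int n = 9 * of_int (n div 9) + of_int k" by (metis of_int_add of_int_mult of_int_numeral)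
  then have e: "(of_int n + f) / 3 = 3 * of_int (n div 9) + (k + f) / 3" by (simp add: field_simps)
  have k': "real_of_int k \<ge> 0" "real_of_int k \<le> 8" using k by linarith+
  have "trap3 ((of_int n + f) / 3) = min (min ((k + f)/3) (3 - (k + f)/3)) 1"
    unfolding e by (rule trap3_add_int) (use k' assms in auto)
  moreover have "3 * min (min ((k + f)/3) (3 - (k + f)/3)) 1 =
    (if k < 3 then of_int k + f else if k < 6 then 3 else 9 - of_int k - f)"
  proof -
    consider "k \<le> 2" | "3 \<le> k" "k \<le> 5" | "6 \<le> k"
      by linarith
    moreover define x where "x = (k + f) / 3"
    moreover have "real_of_int k = 3 * x - f" unfolding x_def by argo
    ultimately show ?thesis
      using assms unfolding x_def[symmetric] by cases (auto simp: min_def)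
  qed
  ultimately show ?thesis
    using assms unfolding k_def[symmetric] by simp
qed

text \<open>
  The piecewise linear core of the contraction. Here \<open>n\<^sub>i + r\<^sub>i\<close> is three times the \<open>i\<close>-th of the
  three points; \<open>u\<close> and \<open>v\<close> stand for the largest and smallest fractional part.
\<close>
lemma trap3_sum_ineq:
  fixes n1 n2 n3 :: int and r1 r2 r3 :: real
  assumes r: "0 \<le> r1" "r1 < 1" "0 \<le> r2" "r2 < 1" "0 \<le> r3" "r3 < 1"
    and n: "n1 \<ge> n2" "n2 \<ge> n3" "0 \<le> n3" "n3 < 3"
    and ord: "of_int n1 + r1 \<ge> of_int n2 + r2" "of_int n2 + r2 \<ge> of_int n3 + r3"
    and u: "u \<in> {r1, r2, r3}" and v: "v \<in> {r1, r2, r3}"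
  shows "trap3 (of_int (n1 + n2 + n3) + (r1 + r2 + r3))
     + 3 * trap3 ((of_int (n1 + n2 + n3) + (r1 + r2 + r3)) / 3) + (u - v)
     \<le> trap3 (of_int n1 + r1) + trap3 (of_int n2 + r2) + trap3 (of_int n3 + r3)
       + trap3 (r1 + r2 + r3) + ((of_int n1 + r1) - (of_int n3 + r3))"
proof (cases "n1 - n3 \<ge> 6")
  \<comment> \<open>The spread exceeds 6 - 1 = 5, while the left side is at most 1 + 3 + 1. Only
    finitely many integer configurations remain.\<close>
  case True
  then have "real_of_int n1 - n3 \<ge> 6" by linarith
  moreover have "u - v \<le> 1" using u v r by auto
  ultimately show ?thesis
    using r trap3_bounds(1)[of "of_int n1 + r1"] trap3_bounds(1)[of "of_int n2 + r2"]
      trap3_bounds(1)[of "of_int n3 + r3"] trap3_bounds(1)[of "r1 + r2 + r3"]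
      trap3_bounds(2)[of "of_int (n1 + n2 + n3) + (r1 + r2 + r3)"]
      trap3_bounds(2)[of "(of_int (n1 + n2 + n3) + (r1 + r2 + r3)) / 3"]
    by linarith
next
  case False
  \<comment> \<open>The sum of the remainders may carry; splitting off \<open>q\<close> puts it and
    the full sum in unit intervals with the same offset \<open>f\<close>.\<close>
  define q where "q = \<lfloor>r1 + r2 + r3\<rfloor>"
  define f where "f = frac (r1 + r2 + r3)"
  have f: "0 \<le> f" "f \<le> 1" by (simp_all add: f_def frac_lt_1 less_imp_le)
  have R: "r1 + r2 + r3 = of_int q + f" by (simp add: q_def f_def frac_def)
  have q: "q \<in> {0, 1, 2}" using r unfolding q_def by simp linarith
  have S: "of_int (n1 + n2 + n3) + (r1 + r2 + r3) = of_int (n1 + n2 + n3 + q) + f"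
    using R by simp
  have n3: "n3 \<in> {0, 1, 2}" using n by auto
  have "n2 - n3 \<in> {0, 1, 2, 3, 4, 5}" using n False by auto
  moreover define d2 where "d2 = n2 - n3"
  ultimately have d2: "n2 = n3 + d2" "d2 \<in> {0, 1, 2, 3, 4, 5}" by auto
  have "n1 - n2 \<in> {0, 1, 2, 3, 4, 5}" using n False by auto
  moreover define d1 where "d1 = n1 - n2"
  ultimately have d1: "n1 = n3 + d2 + d1" "d1 \<in> {0, 1, 2, 3, 4, 5}" using d2 by auto
  have d12: "d1 + d2 \<le> 5" using False d1 d2 by simp
  define A1 where "A1 = trap3 (of_int n1 + r1)"
  define A2 where "A2 = trap3 (of_int n2 + r2)"
  define A3 where "A3 = trap3 (of_int n3 + r3)"
  define hR where "hR = trap3 (of_int q + f)"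
  define hS where "hS = trap3 (of_int (n1 + n2 + n3 + q) + f)"
  define gS where "gS = 3 * trap3 ((of_int (n1 + n2 + n3 + q) + f) / 3)"
  note T = A1_def[unfolded trap3_unit[OF r(1) less_imp_le[OF r(2)]]]
    A2_def[unfolded trap3_unit[OF r(3) less_imp_le[OF r(4)]]]
    A3_def[unfolded trap3_unit[OF r(5) less_imp_le[OF r(6)]]]
    hR_def[unfolded trap3_unit[OF f]] hS_def[unfolded trap3_unit[OF f]]
    gS_def[unfolded trap3_third_unit[OF f]]
  \<comment> \<open>Each alternative makes \<open>u - v\<close> affine in the remainders.\<close>
  have w: "u - v = r1 - r2 \<or> u - v = r1 - r3 \<or> u - v = r2 - r3 \<or>
      u - v = r2 - r1 \<or> u - v = r3 - r1 \<or> u - v = r3 - r2 \<or> u - v = 0"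
    using u v by auto
  define x1 where "x1 = real_of_int n1"
  define x2 where "x2 = real_of_int n2"
  define x3 where "x3 = real_of_int n3"
  define y where "y = real_of_int q"
  have "hS + gS + (u - v) \<le> A1 + A2 + A3 + hR + ((x1 + r1) - (x3 + r3))"
  proof -
    have "d2 = 0 \<or> d2 = 1 \<or> d2 = 2 \<or> d2 = 3 \<or> d2 = 4 \<or> d2 = 5"
      "d1 = 0 \<or> d1 = 1 \<or> d1 = 2 \<or> d1 = 3 \<or> d1 = 4 \<or> d1 = 5"
      "n3 = 0 \<or> n3 = 1 \<or> n3 = 2" "q = 0 \<or> q = 1 \<or> q = 2"
      using d1 d2 n3 q by auto
    then show ?thesis
      using T d12 x1_def x2_def x3_def y_def unfolding d1(1) d2(1)
      \<comment> \<open>With the integers fixed, every term is affine in \<open>r1, r2, r3, f\<close>; the facts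
        in these variables are inserted late because they slow \<open>simp\<close> down.\<close>
      by (elim disjE)
        (simp; insert r f w R[folded y_def] ord[folded x1_def x2_def x3_def]; argo)+
  qed
  then show ?thesis
    unfolding S unfolding R A1_def A2_def A3_def hR_def hS_def gS_def x1_def x3_def by simp
qed

lemma trap3_periodic: "trap3 (x + 3 * of_int m) = trap3 x"
  using int_dist_third_periodic[of "x / 3" m] by (simp add: trap3_def add_divide_distrib)

lemma trap3_sum_ineq_floor:
  fixes a b c :: real
  assumes ord: "a \<ge> b" "b \<ge> c"
    and u: "u \<in> {frac a, frac b, frac c}" and v: "v \<in> {frac a, frac b, frac c}"
  shows "trap3 (a + b + c) + 3 * trap3 ((a + b + c) / 3) + (u - v)
     \<le> trap3 a + trap3 b + trap3 c + trap3 (frac a + frac b + frac c) + (a - c)"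
proof -
  \<comment> \<open>A common shift by \<open>3 * m\<close> keeps the spread and brings the floor of
    \<open>c\<close> into {0, 1, 2}. The sum moves by \<open>9 * m\<close> and its third by
    \<open>3 * m\<close>, both multiples of the period 3.\<close>
  define m where "m = \<lfloor>c\<rfloor> div 3"
  define n1 where "n1 = \<lfloor>a\<rfloor> - 3 * m"
  define n2 where "n2 = \<lfloor>b\<rfloor> - 3 * m"
  define n3 where "n3 = \<lfloor>c\<rfloor> - 3 * m"
  have e: "a = (of_int n1 + frac a) + 3 * of_int m" "b = (of_int n2 + frac b) + 3 * of_int m"
      "c = (of_int n3 + frac c) + 3 * of_int m"
    by (simp_all add: n1_def n2_def n3_def frac_def)
  define S where "S = of_int (n1 + n2 + n3) + (frac a + frac b + frac c)"
  have S: "a + b + c = S + 3 * of_int (3 * m)" "(a + b + c) / 3 = S / 3 + 3 * of_int m"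
    using e unfolding S_def of_int_add of_int_mult of_int_numeral by argo+
  have n: "n1 \<ge> n2" "n2 \<ge> n3" "0 \<le> n3" "n3 < 3"
    using floor_mono[OF ord(1)] floor_mono[OF ord(2)] unfolding n1_def n2_def n3_def m_def
    by simp_all
  have "trap3 S + 3 * trap3 (S / 3) + (u - v)
     \<le> trap3 (of_int n1 + frac a) + trap3 (of_int n2 + frac b) + trap3 (of_int n3 + frac c)
       + trap3 (frac a + frac b + frac c) + ((of_int n1 + frac a) - (of_int n3 + frac c))"
    unfolding S_def using n u v ord e
    by (intro trap3_sum_ineq) (simp_all add: frac_lt_1)
  moreover have "trap3 a = trap3 (of_int n1 + frac a)" "trap3 b = trap3 (of_int n2 + frac b)"
    "trap3 c = trap3 (of_int n3 + frac c)"
    by (metis e trap3_periodic)+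
  ultimately show ?thesis
    unfolding S(2) unfolding S(1) trap3_periodic using e by linarith
qed

section \<open>The three-point inequality\<close>

text \<open>By \<open>omega3_rec\<close> the first two terms equal
  \<open>3 * omega3 ((a + b + c) / 3)\<close>, so this is the defect of the three-point inequality.
  In this form \<open>omega3\<close> has no divided argument, so integer shifts of the points do not
  affect it.\<close>

definition ternary_gap :: "real \<Rightarrow> real \<Rightarrow> real \<Rightarrow> real" where
  "ternary_gap a b c = omega3 (a + b + c) + trap3 (a + b + c)
     - omega3 a - omega3 b - omega3 c - (max a (max b c) - min a (min b c))"

lemma ternary_gap_swap:
  "ternary_gap b a c = ternary_gap a b c" "ternary_gap a c b = ternary_gap a b c"
  by (simp_all add: ternary_gap_def add_ac max.left_commute min.left_commute max.commute min.commute)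

lemma omega3_frac: "omega3 (frac x) = omega3 x"
  using omega3_periodic[of "frac x" "\<lfloor>x\<rfloor>"] by (simp add: frac_def)

text \<open>Expanding every \<open>omega3\<close> once leaves \<open>omega3\<close> values that
  depend only on fractional parts; \<open>trap3_sum_ineq_floor\<close> at the tripled points handles
  all other terms.\<close>

lemma ternary_gap_step_sorted:
  assumes ord: "a \<ge> b" "b \<ge> c"
  shows "ternary_gap a b c \<le> ternary_gap (frac (3 * a)) (frac (3 * b)) (frac (3 * c)) / 3"
proof -
  define r1 r2 r3 where r: "r1 = frac (3 * a)" "r2 = frac (3 * b)" "r3 = frac (3 * c)"
  define S where "S = 3 * a + 3 * b + 3 * c"
  define u where "u = max r1 (max r2 r3)"
  define v where "v = min r1 (min r2 r3)"
  have "u \<in> {r1, r2, r3}" "v \<in> {r1, r2, r3}"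
    by (auto simp: u_def v_def max_def min_def)
  then have ineq: "trap3 S + 3 * trap3 (S / 3) + (u - v)
     \<le> trap3 (3 * a) + trap3 (3 * b) + trap3 (3 * c) + trap3 (r1 + r2 + r3) + (3 * a - 3 * c)"
    unfolding S_def r by (intro trap3_sum_ineq_floor) (use ord in auto)
  have rec: "omega3 x = trap3 (3 * x) / 3 + omega3 (3 * x) / 3" for x
    using omega3_rec[of x] by (simp add: trap3_def)
  \<comment> \<open>\<open>omega3\<close> has period 1 and ignores the carry; \<open>trap3\<close>
    has period 3 and does not, hence the separate terms \<open>trap3 S\<close> and
    \<open>trap3 (r1 + r2 + r3)\<close>.\<close>
  have "S = r1 + r2 + r3 + of_int (\<lfloor>3 * a\<rfloor> + \<lfloor>3 * b\<rfloor> + \<lfloor>3 * c\<rfloor>)"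
    by (simp add: S_def r frac_def)
  then have "omega3 S = omega3 (r1 + r2 + r3)"
    by (metis omega3_periodic)
  then have "omega3 (a + b + c) = trap3 S / 3 + omega3 (r1 + r2 + r3) / 3"
    using rec[of "a + b + c"] by (simp add: S_def distrib_left)
  moreover have "omega3 a = trap3 (3 * a) / 3 + omega3 r1 / 3"
    "omega3 b = trap3 (3 * b) / 3 + omega3 r2 / 3" "omega3 c = trap3 (3 * c) / 3 + omega3 r3 / 3"
    unfolding r omega3_frac by (rule rec)+
  moreover have "max a (max b c) - min a (min b c) = a - c"
    using ord by auto
  moreover have "trap3 (a + b + c) = trap3 (S / 3)" by (simp add: S_def add_divide_distrib)
  ultimately have "ternary_gap a b c = (trap3 S + omega3 (r1 + r2 + r3)) / 3 + trap3 (S / 3)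
     - (trap3 (3 * a) + omega3 r1) / 3 - (trap3 (3 * b) + omega3 r2) / 3
     - (trap3 (3 * c) + omega3 r3) / 3 - (a - c)"
    unfolding ternary_gap_def by argo
  moreover have "ternary_gap r1 r2 r3 = omega3 (r1 + r2 + r3) + trap3 (r1 + r2 + r3)
     - omega3 r1 - omega3 r2 - omega3 r3 - (u - v)"
    by (simp add: ternary_gap_def u_def v_def)
  ultimately show ?thesis
    using ineq unfolding r[symmetric] by argo
qed

lemma ternary_gap_step:
  "ternary_gap a b c \<le> ternary_gap (frac (3 * a)) (frac (3 * b)) (frac (3 * c)) / 3"
proof -
  consider "a \<ge> b" "b \<ge> c" | "a \<ge> c" "c \<ge> b" | "b \<ge> a" "a \<ge> c"
    | "b \<ge> c" "c \<ge> a" | "c \<ge> a" "a \<ge> b" | "c \<ge> b" "b \<ge> a"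
    by linarith
  then show ?thesis
    by cases (metis ternary_gap_step_sorted ternary_gap_swap)+
qed

lemma ternary_gap_nonpos: "ternary_gap a b c \<le> 0"
proof -
  let ?f = "\<lambda>(a, b, c). ternary_gap a b c"
  have "?f (a, b, c) \<le> 0"
  proof (rule contraction_nonpos[where f = ?f and A = UNIV and C = 2])
    show "?f p \<le> 2" for p
    proof -
      obtain a b c where p: "p = (a, b, c)" by (cases p)
      have "min a (min b c) \<le> max a (max b c)" by (simp add: max_def min_def)
      then show ?thesis
        using omega3_bounds(2)[of "a + b + c"] trap3_bounds(2)[of "a + b + c"]
          omega3_bounds(1)[of a] omega3_bounds(1)[of b] omega3_bounds(1)[of c]
        unfolding p ternary_gap_def by simp
    qed
    show "\<exists>q\<in>UNIV. ?f p \<le> ?f q / 3" for p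
    proof -
      obtain a b c where p: "p = (a, b, c)" by (cases p)
      show ?thesis
        using ternary_gap_step[of a b c] unfolding p
        by (intro bexI[of _ "(frac (3 * a), frac (3 * b), frac (3 * c))"]) auto
    qed
  qed simp
  then show ?thesis by simp
qed

lemma omega3_average:
  "omega3 ((a + b + c) / 3)
     \<le> (omega3 a + omega3 b + omega3 c + (max a (max b c) - min a (min b c))) / 3"
proof -
  have "3 * ((a + b + c) / 3) = a + b + c" by simp
  then have "omega3 ((a + b + c) / 3) = int_dist_third ((a + b + c) / 3) + omega3 (a + b + c) / 3"
    using omega3_rec by metis
  then show ?thesis
    using ternary_gap_nonpos[of a b c] unfolding ternary_gap_def trap3_def by argo
qed

section \<open>From three equal weights to arbitrary weights\<close>

theorem theorem4:
  fixes x\<^sub>1 x\<^sub>2 t :: real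
  assumes "t \<in> {0..1}"
  shows "omega3 (t * x\<^sub>1 + (1 - t) * x\<^sub>2)
           \<le> t * omega3 x\<^sub>1 + (1 - t) * omega3 x\<^sub>2 + omega3 t * \<bar>x\<^sub>2 - x\<^sub>1\<bar>"
proof -
  let ?h = "\<bar>x\<^sub>2 - x\<^sub>1\<bar>"
  define z where "z s = s * x\<^sub>1 + (1 - s) * x\<^sub>2" for s
  define f where "f s = omega3 (z s) - (s * omega3 x\<^sub>1 + (1 - s) * omega3 x\<^sub>2 + omega3 s * ?h)" for s
  have z_diff: "\<bar>x\<^sub>2 - z s\<bar> = s * ?h" "\<bar>z s - x\<^sub>1\<bar> = (1 - s) * ?h" if "s \<in> {0..1}" for s
  proof -
    have "x\<^sub>2 - z s = s * (x\<^sub>2 - x\<^sub>1)" "z s - x\<^sub>1 = (1 - s) * (x\<^sub>2 - x\<^sub>1)"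
      by (simp_all add: z_def algebra_simps)
    then show "\<bar>x\<^sub>2 - z s\<bar> = s * ?h" "\<bar>z s - x\<^sub>1\<bar> = (1 - s) * ?h"
      using that by (simp_all add: abs_mult)
  qed
  have "f t \<le> 0"
  proof (rule contraction_nonpos[where f = f and A = "{0..1}" and C = "1/2"])
    fix s :: real assume s: "s \<in> {0..1}"
    have "0 \<le> s * omega3 x\<^sub>1" "0 \<le> (1 - s) * omega3 x\<^sub>2" "0 \<le> omega3 s * ?h"
      using s by (simp_all add: omega3_bounds)
    then show "f s \<le> 1/2"
      using omega3_bounds(2)[of "z s"] unfolding f_def by linarith
  next
    fix s :: real assume s: "s \<in> {0..1}"
    \<comment> \<open>These are the three branches of \<open>int_dist_third\<close> on [0, 1]. In
      each, a third of the spread of the three averaged points is exactly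
      \<open>int_dist_third s * ?h\<close>, the first term of \<open>omega3_rec\<close> for
      \<open>omega3 s * ?h\<close>.\<close>
    consider (0) "s \<le> 1/3" | (1) "1/3 \<le> s" "s \<le> 2/3" | (2) "2/3 \<le> s" by linarith
    then show "\<exists>s'\<in>{0..1}. f s \<le> f s' / 3"
    proof cases
      case 0
      define s' where "s' = 3 * s"
      have s': "s' \<in> {0..1}" using 0 s by (simp add: s'_def)
      have "int_dist_third s = s" using int_dist_third_add_int[of s 0] 0 s by auto
      then have om: "omega3 s = (s' + omega3 s') / 3"
        using omega3_rec[of s] by (simp add: s'_def)
      have z_eq: "z s = (z s' + x\<^sub>2 + x\<^sub>2) / 3"
        by (simp add: z_def s'_def algebra_simps)
      have "max (z s') (max x\<^sub>2 x\<^sub>2) - min (z s') (min x\<^sub>2 x\<^sub>2) = \<bar>x\<^sub>2 - z s'\<bar>"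
        by (auto simp: max_def min_def)
      then have "omega3 (z s) \<le> (omega3 (z s') + omega3 x\<^sub>2 + omega3 x\<^sub>2 + s' * ?h) / 3"
        unfolding z_eq using omega3_average[of "z s'" x\<^sub>2 x\<^sub>2] z_diff[OF s'] by simp
      then have "f s \<le> f s' / 3"
        unfolding f_def om by (simp add: s'_def field_simps)
      then show ?thesis using s' by blast
    next
      case 1
      define s' where "s' = 3 * s - 1"
      have s': "s' \<in> {0..1}" using 1 by (simp add: s'_def)
      have "int_dist_third s = 1/3" using int_dist_third_add_int[of s 0] 1 by auto
      moreover have "omega3 (3 * s) = omega3 s'"
        using omega3_periodic[of s' 1] by (simp add: s'_def)
      ultimately have om: "omega3 s = (1 + omega3 s') / 3"
        using omega3_rec[of s] by simp
      have z_eq: "z s = (z s' + x\<^sub>1 + x\<^sub>2) / 3"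
        by (simp add: z_def s'_def algebra_simps)
      \<comment> \<open>The distances add up to \<open>?h\<close>, so \<open>z s'\<close> lies
        between the endpoints and does not enlarge the spread.\<close>
      have "\<bar>x\<^sub>2 - z s'\<bar> + \<bar>z s' - x\<^sub>1\<bar> = ?h"
        using z_diff[OF s'] by (simp add: algebra_simps)
      then have "max (z s') (max x\<^sub>1 x\<^sub>2) - min (z s') (min x\<^sub>1 x\<^sub>2) = ?h"
        by (auto simp: max_def min_def)
      then have "omega3 (z s) \<le> (omega3 (z s') + omega3 x\<^sub>1 + omega3 x\<^sub>2 + ?h) / 3"
        unfolding z_eq using omega3_average[of "z s'" x\<^sub>1 x\<^sub>2] by simp
      then have "f s \<le> f s' / 3"
        unfolding f_def om by (simp add: s'_def field_simps)
      then show ?thesis using s' by blast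
    next
      case 2
      define s' where "s' = 3 * s - 2"
      have s': "s' \<in> {0..1}" using 2 s by (simp add: s'_def)
      have "int_dist_third s = 1 - s" using int_dist_third_add_int[of s 0] 2 s by auto
      moreover have "omega3 (3 * s) = omega3 s'"
        using omega3_periodic[of s' 2] by (simp add: s'_def)
      ultimately have om: "omega3 s = (1 - s' + omega3 s') / 3"
        using omega3_rec[of s] by (simp add: s'_def)
      have z_eq: "z s = (z s' + x\<^sub>1 + x\<^sub>1) / 3"
        by (simp add: z_def s'_def algebra_simps)
      have "max (z s') (max x\<^sub>1 x\<^sub>1) - min (z s') (min x\<^sub>1 x\<^sub>1) = \<bar>z s' - x\<^sub>1\<bar>"
        by (auto simp: max_def min_def)
      then have "omega3 (z s) \<le> (omega3 (z s') + omega3 x\<^sub>1 + omega3 x\<^sub>1 + (1 - s') * ?h) / 3"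
        unfolding z_eq using omega3_average[of "z s'" x\<^sub>1 x\<^sub>1] z_diff[OF s'] by simp
      then have "f s \<le> f s' / 3"
        unfolding f_def om by (simp add: s'_def field_simps)
      then show ?thesis using s' by blast
    qed
  qed (use assms in simp)
  then show ?thesis by (simp add: f_def z_def)
qed

end
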